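(* For all $n, d, L \in \{1,2,3,\dots\}$, $$\mathsf{VC}\text{-}\mathsf{dim}_{\mathcal{G}_{d,n}^{\mathbb{B}}}\bigl(\mathsf{GNN}(L)\bigr) \leq m_{n,d,L},$$ where $\mathcal{G}_{d,n}^{\mathbb{B}}$ is the class of graphs of order at most $n$ with $d$-dimensional boolean vertex features, $\mathsf{GNN}(L)$ is the class of all $L$-layer graph neural networks, and $m_{n,d,L}$ is the maximal number of graphs in $\mathcal{G}_{d,n}^{\mathbb{B}}$ that are pairwise distinguishable by the $1$-dimensional Weisfeiler--Leman algorithm after $L$ iterations.
   Context: **Graphs.** Graphs are finite, undirected, without self-loops. The order of $G$ is $|V(G)|$, and $N(v)$ is the neighborhood of $v$. A graph with $d$-dimensional features is a pair $\mathbf{G}=(G,\mathbf{L})$ with $V(G)=[|V(G)|]$ and $\mathbf{L}\in\mathbb{R}^{|V(G)|\times d}$; the feature of $v$ is the row $\mathbf{L}_{v\cdot}$. Features are boolean if $\mathbf{L}$ has entries in $\{0,1\}$. $\mathcal{G}_{d,n}^{\mathbb{B}}$ is the class of all graphs of order at most $n$ with $d$-dimensional boolean vertex features. **$1$-WL.** The $1$-dimensional Weisfeiler--Leman algorithm computes vertex colorings $C_t^1$: $C^1_0(v)$ is determined by the feature of $v$ (two vertices, possibly in different graphs, get the same initial color iff they have the same feature), and for $t>0$ $$C^1_t(v) = \mathsf{RELABEL}\bigl(C^1_{t-1}(v), \{\!\!\{ C^1_{t-1}(u) \mid u \in N(v)\}\!\!\}\bigr),$$ where $\mathsf{RELABEL}$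 is an injective map to fresh colors, the same for all graphs. Two graphs are distinguished by $1$-WL after $L$ iterations if at some iteration $t\le L$ there is a color $c$ such that the two graphs have a different number of vertices of color $c$. $m_{n,d,L}$ is the maximal size of a set of graphs in $\mathcal{G}_{d,n}^{\mathbb{B}}$ that are pairwise distinguished by $1$-WL after $L$ iterations. **GNNs.** An $L$-layer GNN computes, on a graph with features, $\mathbf{h}_v^{(0)}=\mathbf{L}_{v\cdot}$ and, for $t\in[L]$, $$\mathbf{h}_{v}^{(t)} = \mathsf{UPD}^{(t)}\Bigl(\mathbf{h}_{v}^{(t-1)},\mathsf{AGG}^{(t)}\bigl(\{\!\!\{ \mathbf{h}_{u}^{(t-1)} \mid u\in N(v)\}\!\!\}\bigr)\Bigr),$$ followed by the readout $\mathsf{gnn}(\mathbf{G}) = \mathsf{READOUT}\bigl(\{\!\!\{ \mathbf{h}_{v}^{(L)}\mid v\in V(G)\}\!\!\}\bigr)\in\mathbb{R}$, where the intermediate features are real vectors of arbitrary finite dimensions and $\mathsf{UPD}^{(t)}$, $\mathsf{AGG}^{(t)}$, $\mathsf{READOUT}$ are arbitrary functions of the indicated kind. $\mathsf{GNN}(L)$ is the class of all such GNNs. **VC dimension.** For a class $\mathcal{C}$ of GNNs and a class $\mathcal{X}$ of graphs, graphs $\mathbf{G}_1,\dots,\mathbf{G}_m\in\mathcal{X}$ are shattered by $\mathcal{C}$ if for every $\tau\in\{0,1\}^m$ there is $\mathsf{gnn}\in\mathcal{C}$ such that for all $i\in[m]$: $\mathsf{gnn}(\mathbf{G}_i)\ge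 2/3$ if $\tau_i=1$ and $\mathsf{gnn}(\mathbf{G}_i)\le 1/3$ if $\tau_i=0$. $\mathsf{VC}\text{-}\mathsf{dim}_{\mathcal{X}}(\mathcal{C})$ is the maximal $m$ such that some $m$ graphs in $\mathcal{X}$ are shattered by $\mathcal{C}$. *)

theory Defs
  imports
    Graph_Theory.Pair_Digraph
    Jordan_Normal_Form.Matrix
    "HOL-Library.Multiset"
    "HOL-Library.Extended_Nat"
begin

text \<open>
  Matrix rows are numbered from 0, so the vertex set of a graph of order \<open>N\<close> is
  \<open>{0..<N}\<close> instead of \<open>{1, \<dots>, N}\<close>.  An undirected graph without self-loops is given by a
  symmetric, irreflexive set of arcs (\<open>pair_graph\<close>).
\<close>

type_synonym featured_graph = "nat pair_pre_digraph \<times> real mat"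

definition graph_order :: "featured_graph \<Rightarrow> nat" where
  "graph_order G = card (pverts (fst G))"

definition feature :: "featured_graph \<Rightarrow> nat \<Rightarrow> real vec" where
  "feature G v = row (snd G) v"

definition neighbors :: "featured_graph \<Rightarrow> nat \<Rightarrow> nat set" where
  "neighbors G v = {u. (v, u) \<in> parcs (fst G)}"

definition featured_graphs :: "nat \<Rightarrow> featured_graph set" where
  "featured_graphs d = {G. pair_graph (fst G) \<and> pverts (fst G) = {0..<graph_order G}
     \<and> snd G \<in> carrier_mat (graph_order G) d}"

definition bool_graphs :: "nat \<Rightarrow> nat \<Rightarrow> featured_graph set" where
  "bool_graphs d n = {G \<in> featured_graphs d. graph_order G \<le> n \<and> elements_mat (snd G) \<subseteq> {0, 1}}"

text \<open>
  Colours are taken from a free datatype.  Its constructor \<open>Relabel\<close> is an injective relabelling,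
  shared by all graphs, whose values differ from all previously used colours.
\<close>

datatype color = Initial "real vec" | Relabel color "color multiset"

primrec wl :: "featured_graph \<Rightarrow> nat \<Rightarrow> nat \<Rightarrow> color" where
  "wl G 0 v = Initial (feature G v)"
| "wl G (Suc t) v = Relabel (wl G t v) (image_mset (wl G t) (mset_set (neighbors G v)))"

definition wl_distinguished :: "nat \<Rightarrow> featured_graph \<Rightarrow> featured_graph \<Rightarrow> bool" where
  "wl_distinguished L G H \<longleftrightarrow> (\<exists>t\<le>L. \<exists>c.
     card {v \<in> pverts (fst G). wl G t v = c} \<noteq> card {v \<in> pverts (fst H). wl H t v = c})"

definition wl_max :: "nat \<Rightarrow> nat \<Rightarrow> nat \<Rightarrow> nat" where
  "wl_max n d L = Max {card S |S. S \<subseteq> bool_graphs d n \<and> pairwise (wl_distinguished L) S}"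

text \<open>
  The vertex states after layer \<open>t\<close> have dimension \<open>dim_state A t\<close>, the aggregated messages of
  layer \<open>t\<close> have dimension \<open>dim_agg A t\<close>.  The values of \<open>agg\<close>, \<open>upd\<close> and \<open>readout\<close> on
  vectors of other dimensions, or at layers outside \<open>{1..L}\<close>, are irrelevant.
\<close>

record gnn_arch =
  dim_state :: "nat \<Rightarrow> nat"
  dim_agg :: "nat \<Rightarrow> nat"
  agg :: "nat \<Rightarrow> real vec multiset \<Rightarrow> real vec"
  upd :: "nat \<Rightarrow> real vec \<Rightarrow> real vec \<Rightarrow> real vec"
  readout :: "real vec multiset \<Rightarrow> real"

definition is_gnn :: "nat \<Rightarrow> nat \<Rightarrow> gnn_arch \<Rightarrow> bool" where
  "is_gnn d L A \<longleftrightarrow> dim_state A 0 = d \<and>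
     (\<forall>t\<in>{1..L}.
        (\<forall>M. set_mset M \<subseteq> carrier_vec (dim_state A (t - 1)) \<longrightarrow>
           agg A t M \<in> carrier_vec (dim_agg A t)) \<and>
        (\<forall>x\<in>carrier_vec (dim_state A (t - 1)). \<forall>a\<in>carrier_vec (dim_agg A t).
           upd A t x a \<in> carrier_vec (dim_state A t)))"

primrec gnn_state :: "gnn_arch \<Rightarrow> featured_graph \<Rightarrow> nat \<Rightarrow> nat \<Rightarrow> real vec" where
  "gnn_state A G 0 v = feature G v"
| "gnn_state A G (Suc t) v =
     upd A (Suc t) (gnn_state A G t v)
       (agg A (Suc t) (image_mset (gnn_state A G t) (mset_set (neighbors G v))))"

definition gnn_output :: "nat \<Rightarrow> gnn_arch \<Rightarrow> featured_graph \<Rightarrow> real" where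
  "gnn_output L A G = readout A (image_mset (gnn_state A G L) (mset_set (pverts (fst G))))"

definition GNN :: "nat \<Rightarrow> nat \<Rightarrow> (featured_graph \<Rightarrow> real) set" where
  "GNN d L = {gnn_output L A |A. is_gnn d L A}"

definition shattered :: "('g \<Rightarrow> real) set \<Rightarrow> 'g list \<Rightarrow> bool" where
  "shattered C Gs \<longleftrightarrow> (\<forall>\<tau> :: nat \<Rightarrow> bool. \<exists>f\<in>C. \<forall>i<length Gs.
     (\<tau> i \<longrightarrow> f (Gs ! i) \<ge> 2/3) \<and> (\<not> \<tau> i \<longrightarrow> f (Gs ! i) \<le> 1/3))"

text \<open>The value is \<open>\<infinity>\<close> if arbitrarily many elements of \<open>X\<close> can be shattered.\<close>

definition vc_dim :: "'g set \<Rightarrow> ('g \<Rightarrow> real) set \<Rightarrow> enat" where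
  "vc_dim X C = Sup {enat (length Gs) |Gs. set Gs \<subseteq> X \<and> shattered C Gs}"

lemma finite_bool_mats: "finite {M :: real mat. M \<in> carrier_mat N d \<and> elements_mat M \<subseteq> {0, 1}}"
proof (rule finite_subset)
  let ?I = "{0..<N} \<times> {0..<d}"
  show "finite (mat N d ` (?I \<rightarrow>\<^sub>E {0, 1 :: real}))"
    by (intro finite_imageI finite_PiE) auto
  show "{M :: real mat. M \<in> carrier_mat N d \<and> elements_mat M \<subseteq> {0, 1}}
      \<subseteq> mat N d ` (?I \<rightarrow>\<^sub>E {0, 1})"
  proof (rule subsetI, elim CollectE conjE)
    fix M :: "real mat" assume M: "M \<in> carrier_mat N d" "elements_mat M \<subseteq> {0, 1}"
    have "M = mat N d (restrict (\<lambda>p. M $$ p) ?I)"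
      using M(1) by (intro eq_matI) auto
    moreover have "restrict (\<lambda>p. M $$ p) ?I \<in> ?I \<rightarrow>\<^sub>E {0, 1}"
      using M by (force simp: elements_mat_def)
    ultimately show "M \<in> mat N d ` (?I \<rightarrow>\<^sub>E {0, 1})" by blast
  qed
qed

lemma finite_bool_graphs: "finite (bool_graphs d n)"
proof (rule finite_subset)
  let ?g = "\<lambda>(N, E). \<lparr>pverts = {0..<N}, parcs = E\<rparr> :: nat pair_pre_digraph"
  let ?X = "?g ` ({0..n} \<times> Pow ({0..<n} \<times> {0..<n}))"
  let ?Y = "\<Union>N\<le>n. {M :: real mat. M \<in> carrier_mat N d \<and> elements_mat M \<subseteq> {0, 1}}"
  show "finite (?X \<times> ?Y)"
    by (intro finite_cartesian_product finite_imageI) (auto simp: finite_bool_mats)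
  show "bool_graphs d n \<subseteq> ?X \<times> ?Y"
  proof
    fix G assume "G \<in> bool_graphs d n"
    then have G: "pair_graph (fst G)" "pverts (fst G) = {0..<graph_order G}"
        "snd G \<in> carrier_mat (graph_order G) d" "graph_order G \<le> n" "elements_mat (snd G) \<subseteq> {0, 1}"
      by (auto simp: bool_graphs_def featured_graphs_def)
    interpret pair_graph "fst G" by (fact G(1))
    have "parcs (fst G) \<subseteq> {0..<n} \<times> {0..<n}"
      using G(2,4) in_arcsD1 in_arcsD2 by fastforce
    moreover have "fst G = ?g (graph_order G, parcs (fst G))"
      using G(2) by (cases "fst G") auto
    ultimately have "fst G \<in> ?X" using G(4)
      by (intro image_eqI[where x = "(graph_order G, parcs (fst G))"]) simp_all
    moreover have "snd G \<in> ?Y" using G by auto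
    ultimately show "G \<in> ?X \<times> ?Y" by (simp add: mem_Times_iff)
  qed
qed

lemma finite_wl_sizes:
  "finite {card S |S. S \<subseteq> bool_graphs d n \<and> pairwise (wl_distinguished L) S}"
  "{card S |S. S \<subseteq> bool_graphs d n \<and> pairwise (wl_distinguished L) S} \<noteq> {}"
proof -
  have "{card S |S. S \<subseteq> bool_graphs d n \<and> pairwise (wl_distinguished L) S}
      \<subseteq> card ` Pow (bool_graphs d n)" by auto
  then show "finite {card S |S. S \<subseteq> bool_graphs d n \<and> pairwise (wl_distinguished L) S}"
    by (rule finite_subset) (simp add: finite_bool_graphs)
  have "pairwise (wl_distinguished L) {}" by simp
  then show "{card S |S. S \<subseteq> bool_graphs d n \<and> pairwise (wl_distinguished L) S} \<noteq> {}"
    by blast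
qed

end

theory Submission
  imports Defs
begin

text \<open>
  By induction on the layer, every GNN state is a function of the 1-WL colour of the vertex after
  the same number of iterations, uniformly over all graphs.  A GNN output is thus a function of the
  multiset of colours after \<open>L\<close> iterations.  In a shattered list every two entries are separated by
  some GNN, so the list consists of graphs that are pairwise distinguished by 1-WL.
\<close>

lemma gnn_state_factors_through_wl: "\<exists>f. \<forall>G. gnn_state A G t = f \<circ> wl G t"
proof (induction t)
  case 0
  \<comment> \<open>Colours at iteration 0 are all of the form \<open>Initial x\<close>, so the
    unspecified \<open>Relabel\<close> case is never met.\<close>
  have "gnn_state A G 0 = (\<lambda>c. case c of Initial x \<Rightarrow> x) \<circ> wl G 0" for G
    by (rule ext) simp
  then show ?case by blast
next
  case (Suc t)
  then obtain f where f: "\<And>G. gnn_state A G t = f \<circ> wl G t" by blast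
  \<comment> \<open>A \<open>Relabel\<close> colour retains the old colour and the multiset of
    neighbour colours; applying \<open>f\<close> to both recovers the arguments of
    \<open>upd\<close> and \<open>agg\<close>.\<close>
  have "gnn_state A G (Suc t) = (\<lambda>c. case c of Relabel c M \<Rightarrow>
      upd A (Suc t) (f c) (agg A (Suc t) (image_mset f M))) \<circ> wl G (Suc t)" for G
    by (rule ext) (simp add: f multiset.map_comp)
  then show ?case by blast
qed

text \<open>On a finite vertex set, the multiplicity of a colour in the image multiset is the size
  of its colour class.\<close>

lemma wl_multiset_eq_if_not_distinguished:
  assumes "\<not> wl_distinguished L G H" "finite (pverts (fst G))" "finite (pverts (fst H))"
  shows "image_mset (wl G L) (mset_set (pverts (fst G)))
    = image_mset (wl H L) (mset_set (pverts (fst H)))"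
proof (rule multiset_eqI)
  fix c
  have "card {v \<in> pverts (fst G). wl G L v = c} = card {v \<in> pverts (fst H). wl H L v = c}"
    using assms(1) by (auto simp: wl_distinguished_def)
  then show "count (image_mset (wl G L) (mset_set (pverts (fst G)))) c
      = count (image_mset (wl H L) (mset_set (pverts (fst H)))) c"
    using assms(2,3)
    by (simp add: count_image_mset_eq_card_vimage)
qed

lemma gnn_output_eq_if_not_distinguished:
  assumes "\<not> wl_distinguished L G H" "finite (pverts (fst G))" "finite (pverts (fst H))"
  shows "gnn_output L A G = gnn_output L A H"
proof -
  obtain f where f: "\<And>G. gnn_state A G L = f \<circ> wl G L"
    using gnn_state_factors_through_wl by blast
  show ?thesis
    using wl_multiset_eq_if_not_distinguished[OF assms]
    by (simp add: gnn_output_def f flip: multiset.map_comp)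
qed

lemma shattered_separates:
  assumes "shattered C Gs" "i < length Gs" "j < length Gs" "i \<noteq> j"
  obtains f where "f \<in> C" "f (Gs ! i) \<noteq> f (Gs ! j)"
proof -
  \<comment> \<open>The labelling that is true at \<open>i\<close> only forces a gap between 1/3 and
    2/3.\<close>
  obtain f where f: "f \<in> C" and "\<forall>k<length Gs.
      (k = i \<longrightarrow> f (Gs ! k) \<ge> 2/3) \<and> (k \<noteq> i \<longrightarrow> f (Gs ! k) \<le> 1/3)"
    using assms(1)[unfolded shattered_def, rule_format, of "\<lambda>k. k = i"] by blast
  then have "f (Gs ! i) \<ge> 2/3" "f (Gs ! j) \<le> 1/3" using assms(2-4) by auto
  then show thesis using that f by fastforce
qed

lemma finite_pverts_bool_graphs: "G \<in> bool_graphs d n \<Longrightarrow> finite (pverts (fst G))"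
  unfolding bool_graphs_def featured_graphs_def by (metis (lifting) finite_atLeastLessThan mem_Collect_eq)

theorem proposition1:
  fixes n d L :: nat
  assumes "n \<ge> 1" and "d \<ge> 1" and "L \<ge> 1"
  shows "vc_dim (bool_graphs d n) (GNN d L) \<le> enat (wl_max n d L)"
  unfolding vc_dim_def
proof (rule Sup_least, elim CollectE exE conjE)
  fix x Gs
  assume x: "x = enat (length Gs)" and Gs: "set Gs \<subseteq> bool_graphs d n"
    and shat: "shattered (GNN d L) Gs"
  \<comment> \<open>A repeated graph would give two entries with equal values under every GNN.
    Distinctness turns the length of the list into the cardinality of a set, as
    \<open>wl_max\<close> counts.\<close>
  have "distinct Gs"
    unfolding distinct_conv_nth using shattered_separates[OF shat] by metis
  moreover have "pairwise (wl_distinguished L) (set Gs)"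
  proof (rule pairwiseI)
    fix G H assume GH: "G \<in> set Gs" "H \<in> set Gs" "G \<noteq> H"
    then obtain f where "f \<in> GNN d L" "f G \<noteq> f H"
      using shattered_separates[OF shat] by (metis in_set_conv_nth)
    then obtain A where "gnn_output L A G \<noteq> gnn_output L A H" by (auto simp: GNN_def)
    then show "wl_distinguished L G H"
      using gnn_output_eq_if_not_distinguished finite_pverts_bool_graphs GH Gs by blast
  qed
  ultimately have "length Gs \<le> wl_max n d L"
    unfolding wl_max_def using Gs
    by (intro Max_ge finite_wl_sizes) (auto simp flip: distinct_card)
  then show "x \<le> enat (wl_max n d L)" by (simp add: x)
qed

end
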